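(* Let $n$ be a positive integer. The number of exact factorizations of the cyclic group $\mathbb{Z}_n$ is given by $f_2(\mathbb{Z}_n)=2^{\omega(n)-1}-1$.
   Context: $\omega(n)$ denotes the number of (distinct) prime divisors of $n$. An exact factorization of a finite group $G$ is a pair $(H,K)$ of subgroups of $G$ with $G=HK$ and $H\cap K=1$; in counting, only factorizations in which both $H$ and $K$ are nontrivial are considered. Two exact factorizations $(H,K)$ and $(L,M)$ of $G$ are equivalent if either $H\cong L$ and $K\cong M$, or $H\cong M$ and $K\cong L$ (abstract group isomorphisms). $f_2(G)$ denotes the number of equivalence classes of exact factorizations of $G$.
   Formalization: At n = 1 the formula would read 2^(-1) - 1 = -1/2 although f_2(Z_1) = 0; here the exponent ω(n) - 1 is taken to be 0 when n = 1, so the formula gives 0; for all n > 1 the statement is as given. *)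

theory Defs
  imports "HOL-Algebra.Algebra" "HOL-Computational_Algebra.Primes"
begin

definition omega :: "nat \<Rightarrow> nat" where
  "omega n = card (prime_factors n)"

definition exact_factorization ::
  "('a, 'b) monoid_scheme \<Rightarrow> 'a set \<Rightarrow> 'a set \<Rightarrow> bool" where
  "exact_factorization G H K \<longleftrightarrow>
     subgroup H G \<and> subgroup K G \<and>
     carrier G = H <#>\<^bsub>G\<^esub> K \<and> H \<inter> K = {\<one>\<^bsub>G\<^esub>}"

definition nontrivial_exact_factorizations ::
  "('a, 'b) monoid_scheme \<Rightarrow> ('a set \<times> 'a set) set" where
  "nontrivial_exact_factorizations G =
     {(H, K). exact_factorization G H K \<and> H \<noteq> {\<one>\<^bsub>G\<^esub>} \<and> K \<noteq> {\<one>\<^bsub>G\<^esub>}}"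

abbreviation subgroup_iso ::
  "('a, 'b) monoid_scheme \<Rightarrow> 'a set \<Rightarrow> 'a set \<Rightarrow> bool" where
  "subgroup_iso G H L \<equiv> G\<lparr>carrier := H\<rparr> \<cong> G\<lparr>carrier := L\<rparr>"

definition factorization_equiv ::
  "('a, 'b) monoid_scheme \<Rightarrow> (('a set \<times> 'a set) \<times> ('a set \<times> 'a set)) set" where
  "factorization_equiv G =
     {((H, K), (L, M)).
        (H, K) \<in> nontrivial_exact_factorizations G \<and>
        (L, M) \<in> nontrivial_exact_factorizations G \<and>
        (subgroup_iso G H L \<and> subgroup_iso G K M \<or>
         subgroup_iso G H M \<and> subgroup_iso G K L)}"

definition f2 :: "('a, 'b) monoid_scheme \<Rightarrow> nat" where
  "f2 G = card (nontrivial_exact_factorizations G // factorization_equiv G)"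

(* The formula 2 ^ (omega n - 1) - 1 reads -1/2 at n = 1, where omega n = 0 and
   the true count is 0. With the exponent taken in nat, omega 1 - 1 = 0, so the
   formula gives 0 there; for n > 1 the subtraction does not truncate. *)

end

theory Submission
  imports Defs
begin

hide_const (open) Divisibility.prime

text \<open>
  The cyclic group of order \<open>n\<close> has exactly one subgroup \<open>d\<int>/n\<int>\<close> for every divisor \<open>d\<close> of \<open>n\<close>,
  so isomorphic subgroups coincide. The subgroups belonging to \<open>a\<close> and \<open>b\<close> form an exact
  factorization iff \<open>gcd a b = 1\<close> and \<open>lcm a b = n\<close>, that is, iff \<open>a\<close> is a unitary divisor with
  cofactor \<open>b\<close>. Unitary divisors correspond to sets of primes dividing \<open>n\<close>; for \<open>n > 1\<close>, discarding \<open>1\<close> and \<open>n\<close>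
  leaves \<open>2\<^bsup>\<omega>(n)\<^esup> - 2\<close> ordered factorizations, which equivalence groups into the
  two-element classes \<open>{(H, K), (K, H)}\<close>.
\<close>

section \<open>Unitary divisors and sets of primes\<close>

definition unitary_divisors :: "nat \<Rightarrow> nat set" where
  "unitary_divisors n = {a. a dvd n \<and> coprime a (n div a)}"

text \<open>A prime dividing \<open>a\<close> cannot divide the coprime cofactor, so its whole power
  in \<open>n\<close> lies in \<open>a\<close>. Hence \<open>a\<close> is determined by its set of
  prime divisors, which gives injectivity below.\<close>

lemma multiplicity_unitary_divisor:
  assumes n: "n > 0" and a: "a \<in> unitary_divisors n" and p: "prime p"
  shows "multiplicity p a = (if p dvd a then multiplicity p n else 0)"
proof (cases "p dvd a")
  case True
  from a obtain b where b: "n = a * b"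
    unfolding unitary_divisors_def by auto
  with n have "a > 0" "b > 0" by auto
  with a b have "coprime a b"
    unfolding unitary_divisors_def by simp
  with True p have "\<not> p dvd b"
    by (meson coprime_common_divisor not_prime_unit)
  with b p \<open>a > 0\<close> \<open>b > 0\<close> have "multiplicity p n = multiplicity p a"
    by (simp add: prime_elem_multiplicity_mult_distrib not_dvd_imp_multiplicity_0)
  with True show ?thesis by simp
qed (simp add: not_dvd_imp_multiplicity_0)

lemma bij_betw_unitary_divisors:
  assumes n: "n > 0"
  shows "bij_betw prime_factors (unitary_divisors n) (Pow (prime_factors n))"
  unfolding bij_betw_def
proof
  show "inj_on prime_factors (unitary_divisors n)"
  proof (rule inj_onI)
    fix a b
    assume a: "a \<in> unitary_divisors n" and b: "b \<in> unitary_divisors n"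
      and eq: "prime_factors a = prime_factors b"
    from a b n have pos: "a > 0" "b > 0"
      unfolding unitary_divisors_def by (auto intro: Nat.gr0I)
    have mult: "multiplicity p a = multiplicity p b" if "prime p" for p
    proof -
      from eq pos that have "p dvd a \<longleftrightarrow> p dvd b"
        by (auto simp: prime_factors_dvd set_eq_iff)
      with a b n that show ?thesis
        by (simp add: multiplicity_unitary_divisor)
    qed
    from pos mult show "a = b" by (rule multiplicity_eq_nat)
  qed
next
  show "prime_factors ` unitary_divisors n = Pow (prime_factors n)"
  proof (intro equalityI subsetI)
    fix Q assume "Q \<in> prime_factors ` unitary_divisors n"
    with n show "Q \<in> Pow (prime_factors n)"
      unfolding unitary_divisors_def by (auto dest: dvd_prime_factors[rotated])
  next
    fix Q assume "Q \<in> Pow (prime_factors n)"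
    then have Q: "Q \<subseteq> prime_factors n" by simp
    then have "finite Q" by (rule finite_subset) simp
    \<comment> \<open>Surjectivity: the preimage of \<open>Q\<close> collects the full prime powers
      of \<open>n\<close> at the primes in \<open>Q\<close>; the remaining ones form the
      cofactor.\<close>
    define part where "part S = (\<Prod>p\<in>S. p ^ multiplicity p n)" for S
    let ?a = "part Q" and ?b = "part (prime_factors n - Q)"
    have "?a * ?b = part (prime_factors n)"
      unfolding part_def using prod.subset_diff[OF Q, of "\<lambda>p. p ^ multiplicity p n"]
      by (simp add: mult.commute)
    also have "\<dots> = n"
      unfolding part_def using n prime_factorization_nat by simp
    finally have ab: "?a * ?b = n" .
    with n have "?a > 0" by (auto intro: Nat.gr0I)
    have "coprime (p ^ multiplicity p n) (q ^ multiplicity q n)"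
      if "p \<in> Q" "q \<in> prime_factors n - Q" for p q
      using that Q by (intro coprime_power_left_iff[THEN iffD2] coprime_power_right_iff[THEN iffD2]
          disjI1 primes_coprime) auto
    then have "coprime ?a ?b"
      unfolding part_def by (intro prod_coprime_left prod_coprime_right) auto
    moreover have "n div ?a = ?b"
      using ab \<open>?a > 0\<close> by (metis nonzero_mult_div_cancel_left less_numeral_extra(3))
    moreover have "?a dvd n" using dvd_triv_left[of ?a ?b] unfolding ab .
    ultimately have "?a \<in> unitary_divisors n"
      by (simp add: unitary_divisors_def)
    moreover have "prime_factors ?a = Q"
    proof -
      have "p dvd ?a \<longleftrightarrow> p \<in> Q" if p: "prime p" for p
      proof
        assume "p dvd ?a"
        then obtain q where q: "q \<in> Q" "p dvd q ^ multiplicity q n"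
          unfolding part_def using prime_dvd_prod_iff[OF \<open>finite Q\<close> p] by auto
        then have "p dvd q" using p prime_dvd_power by blast
        moreover have "prime q" using q Q by auto
        ultimately have "p = q" using p primes_dvd_imp_eq by blast
        with q show "p \<in> Q" by simp
      next
        assume "p \<in> Q"
        \<comment> \<open>The exponent is positive because \<open>p\<close> divides
          \<open>n\<close>.\<close>
        with Q have "p dvd p ^ multiplicity p n"
          by (auto simp: prime_factors_multiplicity)
        also have "\<dots> dvd ?a"
          unfolding part_def using \<open>finite Q\<close> \<open>p \<in> Q\<close> by (rule dvd_prodI)
        finally show "p dvd ?a" .
      qed
      with \<open>?a > 0\<close> Q show ?thesis by (auto simp: prime_factors_dvd)
    qed
    ultimately show "Q \<in> prime_factors ` unitary_divisors n" by (metis image_eqI)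
  qed
qed

lemma card_unitary_divisors:
  "n > 0 \<Longrightarrow> card (unitary_divisors n) = 2 ^ omega n"
  using bij_betw_same_card[OF bij_betw_unitary_divisors]
  by (simp add: omega_def card_Pow)

section \<open>Subgroups of the cyclic group\<close>

text \<open>For \<open>n > 0\<close> and \<open>d dvd n\<close> this is the subgroup generated by
  \<open>d\<close>, written on the representatives from 0 to \<open>n - 1\<close>. The index
  \<open>d\<close> is the generator, not the order.\<close>

definition multiples_mod :: "nat \<Rightarrow> nat \<Rightarrow> int set" where
  "multiples_mod n d = {x \<in> carrier (integer_mod_group n). int d dvd x}"

lemma mem_multiples_mod:
  "n > 0 \<Longrightarrow> x \<in> multiples_mod n d \<longleftrightarrow> 0 \<le> x \<and> x < int n \<and> int d dvd x"
  by (auto simp: multiples_mod_def carrier_integer_mod_group)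

lemma mod_mem_multiples_mod:
  "n > 0 \<Longrightarrow> d dvd n \<Longrightarrow> int d dvd x \<Longrightarrow> x mod int n \<in> multiples_mod n d"
  by (simp add: mem_multiples_mod dvd_mod)

lemma subgroup_multiples_mod:
  assumes "n > 0" "d dvd n"
  shows "subgroup (multiples_mod n d) (integer_mod_group n)"
proof (rule group.subgroupI)
  show "multiples_mod n d \<noteq> {}"
    using assms mod_mem_multiples_mod[of n d 0] by auto
qed (use assms in \<open>auto simp: multiples_mod_def carrier_integer_mod_group dvd_mod\<close>)

lemma card_multiples_mod:
  assumes n: "n > 0" and d: "d dvd n"
  shows "card (multiples_mod n d) = n div d"
proof -
  have "d > 0" using assms by (auto intro: Nat.gr0I)
  obtain m where m: "n = d * m" using d by blast
  have "multiples_mod n d = (\<lambda>k. int d * k) ` {0..<int m}"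
    using n \<open>d > 0\<close> m by (auto simp: mem_multiples_mod zero_le_mult_iff elim!: dvdE)
  moreover have "inj_on (\<lambda>k. int d * k) {0..<int m}"
    using \<open>d > 0\<close> by (auto intro: inj_onI)
  ultimately show ?thesis using m \<open>d > 0\<close> by (simp add: card_image)
qed

lemma card_multiples_mod_inject:
  assumes "n > 0" "a dvd n" "b dvd n" "card (multiples_mod n a) = card (multiples_mod n b)"
  shows "a = b"
  using assms by (metis card_multiples_mod dvd_div_eq_iff dvd_div_mult_self mult_left_cancel
      mult_eq_0_iff not_gr_zero)

text \<open>Let \<open>m\<close> be the order of \<open>H\<close>. Each \<open>x\<close> in
  \<open>H\<close> is killed by \<open>m\<close>, so \<open>n\<close> divides \<open>m * x\<close>
  and \<open>n div m\<close> divides \<open>x\<close>. Thus \<open>H\<close> lies in the multiples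
  of \<open>n div m\<close>, a set that also has \<open>m\<close> elements.\<close>

lemma subgroup_integer_mod_group_cases:
  assumes n: "n > 0" and H: "subgroup H (integer_mod_group n)"
  obtains d where "d dvd n" "H = multiples_mod n d"
proof -
  let ?G = "integer_mod_group n"
  interpret G: group ?G by simp
  have fin: "finite (carrier ?G)" using n by (simp add: carrier_integer_mod_group)
  have ord: "order ?G = n" using n by (simp add: order_def carrier_integer_mod_group)
  define m where "m = card H"
  have "m dvd n" using G.lagrange[OF H] ord unfolding m_def by (metis dvd_triv_right)
  then have "m > 0" using n by (auto intro: Nat.gr0I)
  interpret K: group "?G\<lparr>carrier := H\<rparr>" using H by (rule G.subgroup_imp_group)
  have "H \<subseteq> multiples_mod n (n div m)"
  proof
    fix x assume x: "x \<in> H"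
    then have xG: "x \<in> carrier ?G" using H by (rule subgroup.mem_carrier[rotated])
    have "x [^]\<^bsub>?G\<lparr>carrier := H\<rparr>\<^esub> m = 0"
      using K.pow_order_eq_1[of x] x unfolding m_def order_def by simp
    then have "x [^]\<^bsub>?G\<^esub> m = 0"
      using G.nat_pow_consistent by metis
    then have "int n dvd int m * x" by (simp add: mod_eq_0_iff_dvd)
    then have "int m * int (n div m) dvd int m * x"
      using \<open>m dvd n\<close> by (simp flip: of_nat_mult)
    then have "int (n div m) dvd x" using \<open>m > 0\<close> by simp
    with xG show "x \<in> multiples_mod n (n div m)" by (simp add: multiples_mod_def)
  qed
  moreover have "n div m dvd n" using \<open>m dvd n\<close> by (metis dvd_div_mult_self dvd_triv_left)
  moreover have "card (multiples_mod n (n div m)) = m"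
    using n \<open>m dvd n\<close> \<open>m > 0\<close> by (subst card_multiples_mod) auto
  moreover have "finite (multiples_mod n (n div m))"
    using fin by (simp add: multiples_mod_def)
  ultimately have "H = multiples_mod n (n div m)"
    unfolding m_def by (metis card_subset_eq)
  with \<open>n div m dvd n\<close> show ?thesis by (rule that)
qed

text \<open>The order alone determines a subgroup here, so equivalence of factorizations reduces to
  equality up to swapping.\<close>

lemma subgroup_iso_integer_mod_group_iff:
  assumes n: "n > 0" and H: "subgroup H (integer_mod_group n)" and L: "subgroup L (integer_mod_group n)"
  shows "subgroup_iso (integer_mod_group n) H L \<longleftrightarrow> H = L"
proof
  assume "subgroup_iso (integer_mod_group n) H L"
  then have "card H = card L" by (auto dest: iso_same_card)
  moreover obtain a where "a dvd n" "H = multiples_mod n a"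
    using n H by (rule subgroup_integer_mod_group_cases)
  moreover obtain b where "b dvd n" "L = multiples_mod n b"
    using n L by (rule subgroup_integer_mod_group_cases)
  ultimately show "H = L" using n card_multiples_mod_inject by metis
qed (simp add: iso_refl)

section \<open>Exact factorizations as unitary divisors\<close>

text \<open>Covering the carrier corresponds to \<open>gcd a b = 1\<close>, trivial intersection to
  \<open>lcm a b = n\<close>; together these give \<open>a * b = n\<close>.\<close>

lemma exact_factorization_multiples_mod_iff:
  assumes n: "n > 0" and a: "a dvd n" and b: "b dvd n"
  shows "exact_factorization (integer_mod_group n) (multiples_mod n a) (multiples_mod n b)
    \<longleftrightarrow> coprime a b \<and> a * b = n" (is "?L \<longleftrightarrow> ?R")
proof
  let ?G = "integer_mod_group n"
  assume L: ?L
  \<comment> \<open>Reducing modulo \<open>n\<close> covers \<open>n = 1\<close>, where the carrier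
    is \<open>{0}\<close> and does not contain 1.\<close>
  have "1 mod int n \<in> carrier ?G" using n by (simp add: carrier_integer_mod_group)
  with L have "1 mod int n \<in> multiples_mod n a <#>\<^bsub>?G\<^esub> multiples_mod n b"
    by (simp add: exact_factorization_def)
  then obtain x y where "int a dvd x" "int b dvd y" "1 mod int n = (x + y) mod int n"
    by (auto simp: set_mult_def multiples_mod_def)
  let ?g = "int (gcd a b)"
  have "?g dvd int a" "?g dvd int b" "?g dvd int n"
    using dvd_trans[OF gcd_dvd1 a, of b] by (simp_all only: of_nat_dvd_iff gcd_dvd1 gcd_dvd2)
  moreover note \<open>int a dvd x\<close> \<open>int b dvd y\<close>
  ultimately have "?g dvd x + y" by (intro dvd_add) (erule dvd_trans, assumption)+
  \<comment> \<open>As the gcd divides \<open>n\<close>, reduction modulo \<open>n\<close> preserves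
    divisibility by it.\<close>
  with \<open>?g dvd int n\<close> have "?g dvd 1"
    using \<open>1 mod int n = (x + y) mod int n\<close> by (metis dvd_mod_iff)
  then have cop: "coprime a b" by (simp add: coprime_iff_gcd_eq_1)
  \<comment> \<open>The lcm is a common multiple, so its residue lies in both subgroups and must be
    0.\<close>
  have "int (lcm a b) mod int n \<in> multiples_mod n a \<inter> multiples_mod n b"
    using n a b by (intro IntI mod_mem_multiples_mod) auto
  with L have "int (lcm a b) mod int n = 0"
    unfolding exact_factorization_def by auto
  then have "n dvd lcm a b" by presburger
  moreover have "lcm a b dvd n" using a b by (rule lcm_least)
  ultimately have "lcm a b = n" by (simp add: dvd_antisym)
  with cop show ?R by (simp add: lcm_coprime)
next
  let ?G = "integer_mod_group n"
  assume R: ?R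
  then have n_eq: "int n = int a * int b" by auto
  have cop: "coprime (int a) (int b)" using R by simp
  \<comment> \<open>Multiplying the Bezout identity by \<open>x\<close> splits \<open>x\<close> into
    a multiple of \<open>a\<close> plus a multiple of \<open>b\<close>.\<close>
  then obtain u v where uv: "u * int a + v * int b = 1"
    by (metis bezout_int coprime_imp_gcd_eq_1)
  have "carrier ?G \<subseteq> multiples_mod n a <#>\<^bsub>?G\<^esub> multiples_mod n b"
  proof
    fix x assume "x \<in> carrier ?G"
    then have x: "x mod int n = x" using n by (simp add: carrier_integer_mod_group)
    have "x = (u * int a + v * int b) * x" using uv by simp
    also have "\<dots> = int a * (u * x) + int b * (v * x)" by (simp add: algebra_simps)
    finally have "x = (int a * (u * x) mod int n + int b * (v * x) mod int n) mod int n"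
      using x by (metis mod_add_eq)
    moreover have "int a * (u * x) mod int n \<in> multiples_mod n a"
      "int b * (v * x) mod int n \<in> multiples_mod n b"
      using n a b by (simp_all add: mod_mem_multiples_mod)
    ultimately show "x \<in> multiples_mod n a <#>\<^bsub>?G\<^esub> multiples_mod n b"
      unfolding set_mult_def by auto
  qed
  moreover have "multiples_mod n a <#>\<^bsub>?G\<^esub> multiples_mod n b \<subseteq> carrier ?G"
    using n by (auto simp: set_mult_def carrier_integer_mod_group)
  moreover have "multiples_mod n a \<inter> multiples_mod n b = {0}"
  proof -
    have "x = 0" if "0 \<le> x" "x < int n" "int a dvd x" "int b dvd x" for x
    proof -
      have "int n dvd x" using that cop n_eq by (simp add: divides_mult)
      with that show ?thesis using zdvd_imp_le by force
    qed
    then show ?thesis using n by (auto simp: mem_multiples_mod)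
  qed
  ultimately show ?L
    unfolding exact_factorization_def one_integer_mod_group
    by (intro conjI subgroup_multiples_mod n a b equalityI[of "carrier ?G"])
qed

lemma multiples_mod_eq_trivial_iff:
  assumes "n > 0" "d dvd n"
  shows "multiples_mod n d = {0} \<longleftrightarrow> d = n"
proof
  assume "multiples_mod n d = {0}"
  then have "n div d = 1" using card_multiples_mod[OF assms] by simp
  with assms show "d = n" by (metis dvd_div_mult_self mult_1)
next
  assume "d = n"
  then show "multiples_mod n d = {0}"
    using assms by (auto simp: mem_multiples_mod zdvd_not_zless order_le_less)
qed

text \<open>The divisor \<open>n\<close> makes the first factor trivial and 1 makes the second one
  trivial, hence both are removed.\<close>

lemma bij_betw_nontrivial_exact_factorizations:
  assumes n: "n > 0"
  shows "bij_betw (\<lambda>a. (multiples_mod n a, multiples_mod n (n div a)))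
    (unitary_divisors n - {1, n}) (nontrivial_exact_factorizations (integer_mod_group n))"
    (is "bij_betw ?F ?U ?N")
  unfolding bij_betw_def
proof
  show "inj_on ?F ?U"
    using n card_multiples_mod_inject by (intro inj_onI) (auto simp: unitary_divisors_def)
  show "?F ` ?U = ?N"
  proof (intro equalityI subsetI)
    fix x assume "x \<in> ?F ` ?U"
    then obtain a where x: "x = ?F a" and a: "a dvd n" "coprime a (n div a)" "a \<noteq> 1" "a \<noteq> n"
      by (auto simp: unitary_divisors_def)
    then have "n div a dvd n" by (metis dvd_div_mult_self dvd_triv_left)
    moreover have "n div a \<noteq> n" using a n by (metis div_less_dividend dvd_pos_nat less_not_refl nat_neq_iff less_one)
    ultimately show "x \<in> ?N"
      using n a unfolding x nontrivial_exact_factorizations_def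
      by (simp add: exact_factorization_multiples_mod_iff multiples_mod_eq_trivial_iff)
  next
    fix x assume "x \<in> ?N"
    then obtain H K where x: "x = (H, K)" and HK: "exact_factorization (integer_mod_group n) H K"
      and H: "H \<noteq> {0}" and K: "K \<noteq> {0}"
      unfolding nontrivial_exact_factorizations_def by auto
    from HK have "subgroup H (integer_mod_group n)" "subgroup K (integer_mod_group n)"
      unfolding exact_factorization_def by auto
    then obtain a b where a: "a dvd n" "H = multiples_mod n a" and b: "b dvd n" "K = multiples_mod n b"
      using n by (meson subgroup_integer_mod_group_cases)
    with HK n have ab: "coprime a b" "a * b = n"
      by (simp_all add: exact_factorization_multiples_mod_iff)
    then have "n div a = b" using n by auto
    moreover have "a \<noteq> n" "b \<noteq> n"
      using H K a b n by (auto simp: multiples_mod_eq_trivial_iff)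
    ultimately show "x \<in> ?F ` ?U"
      using ab a b x by (intro image_eqI[of _ _ a]) (auto simp: unitary_divisors_def)
  qed
qed

section \<open>Counting equivalence classes\<close>

theorem theorem1p5:
  fixes n :: nat
  assumes "n > 0"
  shows "int (f2 (integer_mod_group n)) = 2 ^ (omega n - 1) - 1"
proof -
  let ?G = "integer_mod_group n"
  let ?N = "nontrivial_exact_factorizations ?G"
  let ?R = "factorization_equiv ?G"
  have sub: "subgroup H ?G \<and> subgroup K ?G" if "(H, K) \<in> ?N" for H K
    using that by (auto simp: nontrivial_exact_factorizations_def exact_factorization_def)
  \<comment> \<open>Swapping uses commutativity. It has no fixed point: \<open>H = K\<close> would
    make \<open>H\<close> equal to the trivial intersection.\<close>
  have swap: "prod.swap x \<in> ?N" and swap_neq: "prod.swap x \<noteq> x" if "x \<in> ?N" for x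
  proof -
    obtain H K where x: "x = (H, K)" by fastforce
    with that sub have "H \<subseteq> carrier ?G" "K \<subseteq> carrier ?G" by (auto dest: subgroup.subset)
    then have "H <#>\<^bsub>?G\<^esub> K = K <#>\<^bsub>?G\<^esub> H"
      by (force simp: set_mult_def add.commute)
    with that x show "prod.swap x \<in> ?N" "prod.swap x \<noteq> x"
      by (auto simp: nontrivial_exact_factorizations_def exact_factorization_def Int_commute)
  qed
  have R: "(x, y) \<in> ?R \<longleftrightarrow> x \<in> ?N \<and> y \<in> ?N \<and> (y = x \<or> y = prod.swap x)" for x y
    using sub assms unfolding factorization_equiv_def
    by (cases x; cases y) (auto simp: subgroup_iso_integer_mod_group_iff)
  have equiv: "equiv ?N ?R"
    by (rule equivI) (auto simp: R refl_on_def sym_def trans_def)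
  have classes: "card c = 2" if "c \<in> ?N // ?R" for c
  proof -
    from that obtain x where x: "x \<in> ?N" "c = ?R `` {x}" by (rule quotientE)
    then have "c = {y. y = x \<or> y = prod.swap x}" using R[of x] swap by blast
    then have "c = {x, prod.swap x}" by blast
    with swap_neq[OF x(1)] show ?thesis by (simp add: eq_commute)
  qed
  have bij: "card ?N = card (unitary_divisors n - {1, n})"
    using bij_betw_same_card[OF bij_betw_nontrivial_exact_factorizations[OF assms]] by simp
  \<comment> \<open>An infinite set has \<open>card\<close> 0, whereas this cardinality is a power
    of 2.\<close>
  have fin: "finite (unitary_divisors n)"
    using assms card_unitary_divisors[OF assms] by (metis card.infinite power_not_zero zero_neq_numeral)
  then have finN: "finite ?N"
    using bij_betw_finite[OF bij_betw_nontrivial_exact_factorizations[OF assms]] by simp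
  \<comment> \<open>The classes partition the factorizations into disjoint pairs.\<close>
  have "2 * card (?N // ?R) = card (\<Union> (?N // ?R))"
    using finN classes equiv quotient_disj[OF equiv]
    by (intro card_partition) (auto simp: Union_quotient finite_quotient equiv_type)
  then have two: "2 * f2 ?G = card (unitary_divisors n - {1, n})"
    unfolding f2_def using bij equiv by (simp add: Union_quotient)
  show ?thesis
  proof (cases "n = 1")
    case True
    then have "unitary_divisors n - {1, n} = {}" by (auto simp: unitary_divisors_def)
    with two have "f2 ?G = 0" by (simp only: card.empty mult_eq_0_iff) simp
    with True show ?thesis by (simp add: omega_def)
  next
    case False
    have "{1, n} \<subseteq> unitary_divisors n" using assms by (auto simp: unitary_divisors_def)
    with fin False two have "2 * f2 ?G = 2 ^ omega n - 2"
      by (simp add: card_Diff_subset card_unitary_divisors assms)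
    \<comment> \<open>Some prime divides \<open>n > 1\<close>, so \<open>omega n\<close> is positive
      and \<open>omega n - 1\<close> is a genuine predecessor, which allows halving
      \<open>2 ^ omega n - 2\<close>.\<close>
    moreover obtain k where k: "omega n = Suc k"
    proof -
      from False obtain p where "prime p" "p dvd n" using prime_factor_nat by blast
      with assms have "prime_factors n \<noteq> {}" by (auto simp: prime_factors_dvd)
      then have "omega n \<noteq> 0" by (simp add: omega_def)
      with that show ?thesis by (metis not0_implies_Suc)
    qed
    ultimately have "f2 ?G = 2 ^ k - 1" by simp
    with k show ?thesis by (simp add: of_nat_diff)
  qed
qed

end
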